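(* For every finite metric space $(X,d_X)$ there exists a tree metric $t_X$ on $X$ such that $$\|d_X-t_X\|_\infty:=\max_{x,x'\in X}|d_X(x,x')-t_X(x,x')|\le \Phi(X).$$
   Context: Logarithms are to base $2$. Hyperbolicity: for a metric space $(Y,d)$ and $p,x,y\in Y$, let $\mathrm{g}_p(x,y):=\frac12\big(d(p,x)+d(p,y)-d(x,y)\big)$. Let $\mathrm{hyp}_p(Y)$ be the smallest $\delta\ge 0$ such that $\mathrm{g}_p(x,z)\ge\min(\mathrm{g}_p(x,y),\mathrm{g}_p(y,z))-\delta$ for all $x,y,z\in Y$, and $\mathrm{hyp}(Y):=\sup_{p\in Y}\mathrm{hyp}_p(Y)$ (a maximum for finite $Y$). A metric $t$ on a finite set $X$ is called a tree metric if $\mathrm{hyp}(X,t)=0$ (equivalently, $(X,t)$ embeds isometrically into a metric tree). A metric graph $\mathcal G$ is a finite, simple, connected graph with a positive length assigned to each edge; its geometric realization (each edge $e$ identified with the interval $[0,l(e)]$) is given the shortest-path metric. $\mathrm{hyp}(\mathcal G)$ denotes the hyperbolicity of this geometric realization, and $\beta_1(\mathcal G)$ the first Betti number of $\mathcal G$, i.e. $1-\#\text{vertices}+\#\text{edges}$. Set $$\phi(\mathcal G):=2\,\mathrm{hyp}(\mathcal G)\,\log\big(4\beta_1(\mathcal G)+4\big).$$ For a finite metric space $X$, $\Phi(X)$ is the smallest possible value (infimum) of $\phi(\mathcal G)$ over all metric graphs $\mathcal G$ into whose geometric realization $X$ can be isometrically embedded. Such a $\mathcal G$ always exists. *)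

theory Defs
  imports "HOL-Analysis.Abstract_Metric_Spaces"
begin

definition gromov_product :: "('a \<Rightarrow> 'a \<Rightarrow> real) \<Rightarrow> 'a \<Rightarrow> 'a \<Rightarrow> 'a \<Rightarrow> real" where
  "gromov_product d p x y = (d p x + d p y - d x y) / 2"

text \<open>
  The defining inequalities are closed in \<open>\<delta>\<close>, so the infimum in \<open>hyp_at\<close> is attained as soon
  as the set is nonempty. For nonempty \<open>Y\<close> with bounded metric (the only case used below, finite
  spaces and realizations of finite graphs) the set is nonempty and the values \<open>hyp_at Y d p\<close>
  are bounded above, so the infimum and supremum in \<open>real\<close> are the intended ones.
\<close>

definition hyp_at :: "'a set \<Rightarrow> ('a \<Rightarrow> 'a \<Rightarrow> real) \<Rightarrow> 'a \<Rightarrow> real" where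
  "hyp_at Y d p = Inf {\<delta>. \<delta> \<ge> 0 \<and> (\<forall>x\<in>Y. \<forall>y\<in>Y. \<forall>z\<in>Y.
     gromov_product d p x z \<ge> min (gromov_product d p x y) (gromov_product d p y z) - \<delta>)}"

definition hyp :: "'a set \<Rightarrow> ('a \<Rightarrow> 'a \<Rightarrow> real) \<Rightarrow> real" where
  "hyp Y d = (SUP p\<in>Y. hyp_at Y d p)"

definition tree_metric :: "'a set \<Rightarrow> ('a \<Rightarrow> 'a \<Rightarrow> real) \<Rightarrow> bool" where
  "tree_metric X t \<longleftrightarrow> finite X \<and> Metric_space X t \<and> hyp X t = 0"

text \<open>Undirected edges are two-element vertex sets; only the lengths of actual edges matter.\<close>

record 'v mgraph =
  verts :: "'v set"
  edges :: "'v set set"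
  len :: "'v set \<Rightarrow> real"

definition metric_graph :: "'v mgraph \<Rightarrow> bool" where
  "metric_graph G \<longleftrightarrow>
     finite (verts G) \<and> verts G \<noteq> {} \<and>
     (\<forall>e\<in>edges G. e \<subseteq> verts G \<and> card e = 2 \<and> len G e > 0) \<and>
     (\<forall>u\<in>verts G. \<forall>v\<in>verts G. (u, v) \<in> {(a, b). {a, b} \<in> edges G}\<^sup>*)"

definition betti1 :: "'v mgraph \<Rightarrow> int" where
  "betti1 G = 1 - int (card (verts G)) + int (card (edges G))"

text \<open>
  As a set, the geometric realization is the disjoint union of the vertices and of the open
  edges: \<open>Inner e s\<close> with \<open>0 < s < len G e\<close> is the point of \<open>e\<close> with coordinate \<open>s\<close>.
  The linear order on vertices only serves to orient edges: the closed edge \<open>e\<close> is identified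
  with the interval from \<open>0\<close> to \<open>len G e\<close> such that \<open>Min e\<close> has coordinate \<open>0\<close> and
  \<open>Max e\<close> has coordinate \<open>len G e\<close>.
\<close>

datatype 'v gpoint = Vertex 'v | Inner "'v set" real

definition realization :: "'v mgraph \<Rightarrow> 'v gpoint set" where
  "realization G = Vertex ` verts G \<union> {Inner e s | e s. e \<in> edges G \<and> 0 < s \<and> s < len G e}"

inductive edge_coord :: "('v::linorder) mgraph \<Rightarrow> 'v set \<Rightarrow> 'v gpoint \<Rightarrow> real \<Rightarrow> bool"
  for G where
  start: "e \<in> edges G \<Longrightarrow> edge_coord G e (Vertex (Min e)) 0"
| stop: "e \<in> edges G \<Longrightarrow> edge_coord G e (Vertex (Max e)) (len G e)"
| inner: "e \<in> edges G \<Longrightarrow> 0 < s \<Longrightarrow> s < len G e \<Longrightarrow> edge_coord G e (Inner e s) s"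

text \<open>
  \<open>path_length G p q a\<close>: some path from \<open>p\<close> to \<open>q\<close> that is a finite concatenation of segments,
  each inside a closed edge, has total length \<open>a\<close>. The shortest-path metric is the infimum of
  these lengths; it is only meaningful for points of the realization.
\<close>

inductive path_length :: "('v::linorder) mgraph \<Rightarrow> 'v gpoint \<Rightarrow> 'v gpoint \<Rightarrow> real \<Rightarrow> bool"
  for G where
  refl: "p \<in> realization G \<Longrightarrow> path_length G p p 0"
| step: "path_length G p q a \<Longrightarrow> edge_coord G e q s \<Longrightarrow> edge_coord G e r s' \<Longrightarrow>
         path_length G p r (a + \<bar>s - s'\<bar>)"

definition path_dist :: "('v::linorder) mgraph \<Rightarrow> 'v gpoint \<Rightarrow> 'v gpoint \<Rightarrow> real" where
  "path_dist G p q = Inf {a. path_length G p q a}"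

definition graph_hyp :: "('v::linorder) mgraph \<Rightarrow> real" where
  "graph_hyp G = hyp (realization G) (path_dist G)"

definition phi :: "('v::linorder) mgraph \<Rightarrow> real" where
  "phi G = 2 * graph_hyp G * log 2 (4 * real_of_int (betti1 G) + 4)"

definition embeds_in :: "'a set \<Rightarrow> ('a \<Rightarrow> 'a \<Rightarrow> real) \<Rightarrow> ('v::linorder) mgraph \<Rightarrow> bool" where
  "embeds_in X d G \<longleftrightarrow>
     (\<exists>f. f ` X \<subseteq> realization G \<and> (\<forall>x\<in>X. \<forall>y\<in>X. path_dist G (f x) (f y) = d x y))"

text \<open>
  Metric graphs are finite, so up to isomorphism all of them have vertices in \<open>nat\<close>.
\<close>

definition Phi :: "'a set \<Rightarrow> ('a \<Rightarrow> 'a \<Rightarrow> real) \<Rightarrow> real" where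
  "Phi X d = Inf {phi G | G :: nat mgraph. metric_graph G \<and> embeds_in X d G}"

definition sup_distance :: "'a set \<Rightarrow> ('a \<Rightarrow> 'a \<Rightarrow> real) \<Rightarrow> ('a \<Rightarrow> 'a \<Rightarrow> real) \<Rightarrow> real" where
  "sup_distance X d t = Max {\<bar>d x x' - t x x'\<bar> | x x'. x \<in> X \<and> x' \<in> X}"

end

theory Submission imports Defs
begin

text \<open>
  Fix a base point \<open>p\<close> of \<open>X\<close>. Replace the Gromov product of \<open>x\<close> and \<open>y\<close> by the best bottleneck over
  all chains from \<open>x\<close> to \<open>y\<close> in \<open>X\<close>: the supremum of the \<open>m\<close> for which some chain has all its
  consecutive Gromov products at least \<open>m\<close>. This \<open>chain_product\<close> satisfies the defining inequality
  of hyperbolicity with \<open>\<delta> = 0\<close>, so it is the Gromov product of a tree (pseudo)metric. If the chain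
  product exceeds the Gromov product by at most \<open>c\<close>, the tree metric falls short of the given one by
  at most \<open>2 c\<close>, and a uniform shift by \<open>c\<close> centres this error (\<open>tree_metric_from_chains\<close>). The tree
  metric is built from \<open>X\<close> alone, so it remains to bound the excess by \<open>phi G\<close> for each metric graph
  \<open>G\<close> containing \<open>X\<close> (\<open>chain_product_le_phi\<close>).

  The excess over an arbitrary chain grows with the logarithm of its length, since each halving costs
  \<open>\<delta> = hyp G\<close> (\<open>halving\<close>). The Betti number \<open>\<beta>\<close> enters because inside \<open>G\<close> every chain can be
  replaced by one with at most \<open>6 \<beta> + 1\<close> links, no matter how many points \<open>X\<close> has. Geodesics between
  consecutive points of a chain with bottleneck \<open>m\<close> stay at distance at least \<open>m\<close> from \<open>p\<close>
  (\<open>steps_above_of_product\<close>), so the chain becomes a walk in \<open>G\<close> above height \<open>m\<close>, where the height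
  is the distance to \<open>p\<close>. Subdivide \<open>G\<close> at the finitely many points that matter and let every point
  but \<open>p\<close> choose a segment that starts a geodesic to \<open>p\<close>. These segments form a spanning tree, and
  exactly \<open>\<beta>\<close> segments are left over (\<open>card_extra_segments\<close>). Two points joined by tree segments above
  height \<open>m\<close> have a common ancestor above height \<open>m\<close>, hence Gromov product at least \<open>m\<close>: one link. A
  left-over segment is crossed by two links, through its highest point (\<open>segment_links\<close>). A walk that
  visits no tree component twice uses each left-over segment at most once in each direction, so
  \<open>2 \<beta>\<close> crossings and \<open>2 \<beta> + 1\<close> tree links suffice (\<open>few_links\<close>).
\<close>

section \<open>Zero hyperbolicity and the four-point condition\<close>

text \<open>Boundedness keeps the infimum and the supremum in the definition of \<open>hyp\<close> from degenerating:
  \<open>3 B\<close> is an admissible \<open>\<delta>\<close> at every base point.\<close>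

lemma gromov_product_ge_minus_hyp:
  assumes "Y \<noteq> {}" and bound: "\<And>x y. x \<in> Y \<Longrightarrow> y \<in> Y \<Longrightarrow> \<bar>D x y\<bar> \<le> B"
    and "p \<in> Y" "x \<in> Y" "y \<in> Y" "z \<in> Y"
  shows "gromov_product D p x z
    \<ge> min (gromov_product D p x y) (gromov_product D p y z) - hyp Y D"
proof -
  define A where "A q = {\<delta>. \<delta> \<ge> 0 \<and> (\<forall>x\<in>Y. \<forall>y\<in>Y. \<forall>z\<in>Y.
     gromov_product D q x z \<ge> min (gromov_product D q x y) (gromov_product D q y z) - \<delta>)}" for q
  have B: "B \<ge> 0"
    using bound[of p p] \<open>p \<in> Y\<close> by linarith
  have gB: "\<bar>gromov_product D q u v\<bar> \<le> 3 * B / 2" if "q \<in> Y" "u \<in> Y" "v \<in> Y" for q u v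
    using bound[of q u] bound[of q v] bound[of u v] that by (simp add: gromov_product_def)
  have mem: "3 * B \<in> A q" if "q \<in> Y" for q
    unfolding A_def using B
  proof (intro CollectI conjI ballI)
    fix u v w assume "u \<in> Y" "v \<in> Y" "w \<in> Y"
    then show "min (gromov_product D q u v) (gromov_product D q v w) - 3 * B
        \<le> gromov_product D q u w"
      using gB[of q u w] gB[of q u v] that by linarith
  qed simp
  have bdd: "bdd_below (A q)" for q
    by (rule bdd_belowI[of _ 0]) (simp add: A_def)
  have hyp_at_le: "hyp_at Y D q \<le> 3 * B" if "q \<in> Y" for q
    unfolding hyp_at_def using cInf_lower[OF mem[OF that] bdd] by (simp add: A_def)
  have "hyp_at Y D p \<le> hyp Y D"
    unfolding hyp_def using hyp_at_le \<open>p \<in> Y\<close> by (intro cSUP_upper bdd_aboveI2) auto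
  moreover have "min (gromov_product D p x y) (gromov_product D p y z)
      - gromov_product D p x z \<le> Inf (A p)"
  proof (rule cInf_greatest)
    show "A p \<noteq> {}"
      using mem \<open>p \<in> Y\<close> by blast
    fix \<delta> assume "\<delta> \<in> A p"
    then have "min (gromov_product D p x y) (gromov_product D p y z) - \<delta> \<le> gromov_product D p x z"
      using assms unfolding A_def by blast
    then show "min (gromov_product D p x y) (gromov_product D p y z)
        - gromov_product D p x z \<le> \<delta>"
      by linarith
  qed
  ultimately show ?thesis
    unfolding hyp_at_def A_def by linarith
qed

lemma hyp_nonneg:
  assumes "Y \<noteq> {}" and bound: "\<And>x y. x \<in> Y \<Longrightarrow> y \<in> Y \<Longrightarrow> \<bar>D x y\<bar> \<le> B"
  shows "hyp Y D \<ge> 0"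
proof -
  obtain p where p: "p \<in> Y"
    using assms(1) by blast
  show ?thesis
    using gromov_product_ge_minus_hyp[OF assms p p p p] by simp
qed

text \<open>The four-point condition is the inequality between Gromov products with \<open>\<delta> = 0\<close>,
  rearranged so that the base point enters symmetrically; with two equal points it is the triangle
  inequality.\<close>

lemma tree_metric_if_four_point:
  assumes "finite X" "X \<noteq> {}"
    and nonneg: "\<And>x y. t x y \<ge> (0::real)"
    and sym: "\<And>x y. t x y = t y x"
    and zero: "\<And>x y. x \<in> X \<Longrightarrow> y \<in> X \<Longrightarrow> t x y = 0 \<longleftrightarrow> x = y"
    and four: "\<And>x y z w. x \<in> X \<Longrightarrow> y \<in> X \<Longrightarrow> z \<in> X \<Longrightarrow> w \<in> X \<Longrightarrow>
       t x y + t z w \<le> max (t x z + t y w) (t x w + t y z)"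
  shows "tree_metric X t"
proof -
  have "Metric_space X t"
  proof
    show "0 \<le> t x y" for x y by (rule nonneg)
    show "t x y = t y x" for x y by (rule sym)
    show "t x y = 0 \<longleftrightarrow> x = y" if "x \<in> X" "y \<in> X" for x y
      using zero that by blast
    show "t x z \<le> t x y + t y z" if "x \<in> X" "y \<in> X" "z \<in> X" for x y z
      using four[of x z y y] zero[of y y] sym[of z y] that by auto
  qed
  moreover have "hyp_at X t p = 0" if "p \<in> X" for p
    unfolding hyp_at_def
  proof (rule cInf_eq_minimum)
    have "min (gromov_product t p x y) (gromov_product t p y z) \<le> gromov_product t p x z"
      if "x \<in> X" "y \<in> X" "z \<in> X" for x y z
      using four[of x z p y] sym[of z p] sym[of x p] sym[of z y] that \<open>p \<in> X\<close>
      by (simp add: gromov_product_def min_def max_def split: if_splits)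
    then show "0 \<in> {\<delta>. \<delta> \<ge> 0 \<and> (\<forall>x\<in>X. \<forall>y\<in>X. \<forall>z\<in>X.
      gromov_product t p x z \<ge> min (gromov_product t p x y) (gromov_product t p y z) - \<delta>)}"
      by auto
  qed simp
  then have "hyp X t = 0"
    using \<open>X \<noteq> {}\<close> by (simp add: hyp_def)
  ultimately show ?thesis
    using \<open>finite X\<close> by (simp add: tree_metric_def)
qed

section \<open>The tree metric built from chains\<close>

definition product_links :: "('a \<Rightarrow> 'a \<Rightarrow> real) \<Rightarrow> 'a \<Rightarrow> 'a set \<Rightarrow> real \<Rightarrow> ('a \<times> 'a) set" where
  "product_links d p X m = {(u, v). u \<in> X \<and> v \<in> X \<and> m \<le> gromov_product d p u v}"

text \<open>The transitive closure keeps chains nonempty: the reflexive closure would relate \<open>x\<close> to itself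
  at every level \<open>m\<close>, so the supremum for \<open>y = x\<close> would not exist.\<close>

definition chain_product :: "('a \<Rightarrow> 'a \<Rightarrow> real) \<Rightarrow> 'a \<Rightarrow> 'a set \<Rightarrow> 'a \<Rightarrow> 'a \<Rightarrow> real" where
  "chain_product d p X x y = Sup {m. (x, y) \<in> (product_links d p X m)\<^sup>+}"

lemma product_links_mono: "m \<le> m' \<Longrightarrow> product_links d p X m' \<subseteq> product_links d p X m"
  by (auto simp: product_links_def)

context Metric_space
begin

lemma gromov_product_sym: "gromov_product d p x y = gromov_product d p y x"
  by (simp add: gromov_product_def commute)

lemma gromov_product_le: "p \<in> M \<Longrightarrow> x \<in> M \<Longrightarrow> y \<in> M \<Longrightarrow> gromov_product d p x y \<le> d p x"
  using triangle[of p x y] by (simp add: gromov_product_def)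

lemma chain_product_bound:
  assumes "(x, y) \<in> (product_links d p M m)\<^sup>+" "p \<in> M"
  shows "m \<le> d p x" "x \<in> M" "y \<in> M"
proof -
  obtain z where "(x, z) \<in> product_links d p M m"
    using assms(1) by (meson tranclD)
  then show "m \<le> d p x" "x \<in> M"
    using gromov_product_le[of p x z] \<open>p \<in> M\<close> by (auto simp: product_links_def)
  obtain w where "(w, y) \<in> product_links d p M m"
    using assms(1) by (meson tranclD2)
  then show "y \<in> M"
    by (auto simp: product_links_def)
qed

lemma chain_product_upper:
  assumes "(x, y) \<in> (product_links d p M m)\<^sup>+" "p \<in> M"
  shows "m \<le> chain_product d p M x y"
  unfolding chain_product_def
  by (rule cSup_upper) (use assms chain_product_bound in \<open>auto intro!: bdd_aboveI[of _ "d p x"]\<close>)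

lemma chain_product_least:
  assumes "p \<in> M" "x \<in> M" "y \<in> M"
    and "\<And>m. (x, y) \<in> (product_links d p M m)\<^sup>+ \<Longrightarrow> m \<le> B"
  shows "chain_product d p M x y \<le> B"
  unfolding chain_product_def
proof (rule cSup_least)
  have "(x, y) \<in> product_links d p M (gromov_product d p x y)"
    using assms by (simp add: product_links_def)
  then show "{m. (x, y) \<in> (product_links d p M m)\<^sup>+} \<noteq> {}"
    by blast
qed (use assms in auto)

lemma gromov_product_le_chain_product:
  assumes "p \<in> M" "x \<in> M" "y \<in> M"
  shows "gromov_product d p x y \<le> chain_product d p M x y"
  by (rule chain_product_upper) (use assms in \<open>auto simp: product_links_def\<close>)

lemma chain_product_le: "p \<in> M \<Longrightarrow> x \<in> M \<Longrightarrow> y \<in> M \<Longrightarrow> chain_product d p M x y \<le> d p x"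
  by (rule chain_product_least) (auto dest: chain_product_bound)

lemma chain_product_sym: "chain_product d p M x y = chain_product d p M y x"
proof -
  have "(product_links d p M m)\<inverse> = product_links d p M m" for m
    by (auto simp: product_links_def gromov_product_sym)
  then have "(x, y) \<in> (product_links d p M m)\<^sup>+ \<longleftrightarrow> (y, x) \<in> (product_links d p M m)\<^sup>+" for m
    by (metis converse_iff trancl_converse)
  then show ?thesis
    by (simp add: chain_product_def)
qed

text \<open>Below both chain products there are chains for each of the two pairs, and these can be
  concatenated.\<close>

lemma chain_product_ultra:
  assumes "p \<in> M" "x \<in> M" "y \<in> M" "z \<in> M"
  shows "min (chain_product d p M x y) (chain_product d p M y z) \<le> chain_product d p M x z"
proof (rule dense_le)
  fix m assume m: "m < min (chain_product d p M x y) (chain_product d p M y z)"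
  have chain: "(u, v) \<in> (product_links d p M m)\<^sup>+"
    if "m < chain_product d p M u v" "u \<in> M" "v \<in> M" for u v
  proof (rule ccontr)
    assume no: "(u, v) \<notin> (product_links d p M m)\<^sup>+"
    have "m' \<le> m" if "(u, v) \<in> (product_links d p M m')\<^sup>+" for m'
      using no that trancl_mono_subset[OF product_links_mono[of m m' d p M]]
      by (cases "m \<le> m'") auto
    then have "chain_product d p M u v \<le> m"
      using that \<open>p \<in> M\<close> by (intro chain_product_least) auto
    then show False
      using that by simp
  qed
  have "(x, z) \<in> (product_links d p M m)\<^sup>+"
    using chain[of x y] chain[of y z] m assms by auto
  then show "m \<le> chain_product d p M x z"
    using \<open>p \<in> M\<close> by (rule chain_product_upper)
qed

text \<open>The pseudometric with Gromov product \<open>chain_product\<close> lies between \<open>d - 2 c\<close> and \<open>d\<close>. Adding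
  \<open>c\<close> to the distance of any two different points lengthens every pendant edge of the tree by \<open>c / 2\<close>,
  so it preserves the four-point condition. It centres the error, and for \<open>c > 0\<close> it separates
  points that the chains had identified.\<close>

lemma tree_metric_from_chains:
  assumes "finite M" "p \<in> M"
    and err: "\<And>x y. x \<in> M \<Longrightarrow> y \<in> M \<Longrightarrow>
      chain_product d p M x y \<le> gromov_product d p x y + c"
  shows "\<exists>t. tree_metric M t \<and> (\<forall>x\<in>M. \<forall>y\<in>M. \<bar>d x y - t x y\<bar> \<le> c)"
proof -
  let ?g = "chain_product d p M"
  define t where "t x y = (if x \<in> M \<and> y \<in> M \<and> x \<noteq> y then d p x + d p y - 2 * ?g x y + c else 0)"
    for x y
  have diag: "?g x x = d p x" if "x \<in> M" for x
    using chain_product_le[of p x x] gromov_product_le_chain_product[of p x x] that assms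
    by (simp add: gromov_product_def)
  have le: "?g x y \<le> d p x" "?g x y \<le> d p y" if "x \<in> M" "y \<in> M" for x y
    using chain_product_le[of p x y] chain_product_le[of p y x] chain_product_sym[of p x y]
      that \<open>p \<in> M\<close> by auto
  have sandwich: "gromov_product d p x y \<le> ?g x y" "?g x y \<le> gromov_product d p x y + c"
    if "x \<in> M" "y \<in> M" for x y
    using gromov_product_le_chain_product err that \<open>p \<in> M\<close> by auto
  have c: "c \<ge> 0"
    using sandwich[of p p] \<open>p \<in> M\<close> by simp
  have pos: "t x y > 0" if "x \<in> M" "y \<in> M" "x \<noteq> y" for x y
  proof (cases "c = 0")
    case True
    then show ?thesis
      using sandwich[of x y] mdist_pos_less[of x y] that
      unfolding t_def gromov_product_def by (auto simp: add_divide_distrib diff_divide_distrib)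
  next
    case False
    then show ?thesis
      using le[of x y] c that by (simp add: t_def)
  qed
  have sym: "t x y = t y x" for x y
    using chain_product_sym[of p x y] by (auto simp: t_def)
  define s where "s x y = d p x + d p y - 2 * ?g x y" for x y
  have s4: "s x y + s z w \<le> max (s x z + s y w) (s x w + s y z)"
    if "x \<in> M" "y \<in> M" "z \<in> M" "w \<in> M" for x y z w
  proof -
    note u = chain_product_ultra[OF \<open>p \<in> M\<close>] and sy = chain_product_sym
    have "min (?g x z + ?g y w) (?g x w + ?g y z) \<le> ?g x y + ?g z w"
      using u[of x z y] u[of x w y] u[of z x w] u[of z y w]
        sy[of p z x] sy[of p z y] sy[of p w y] sy[of p y w] that
      unfolding min_def by (smt (verit))
    then show ?thesis
      by (simp add: s_def min_def max_def split: if_splits)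
  qed
  have s_diag: "s x x = 0" if "x \<in> M" for x
    using diag that by (simp add: s_def)
  have s_nonneg: "s x y \<ge> 0" if "x \<in> M" "y \<in> M" for x y
    using le[of x y] that by (simp add: s_def)
  have s_sym: "s x y = s y x" for x y
    by (simp add: s_def chain_product_sym[of p x y])
  have t_s: "t x y = (if x = y then 0 else s x y + c)" if "x \<in> M" "y \<in> M" for x y
    using that by (simp add: t_def s_def)
  have "tree_metric M t"
  proof (rule tree_metric_if_four_point)
    show "t x y \<ge> 0" for x y
      using pos[of x y] by (cases "x \<in> M \<and> y \<in> M \<and> x \<noteq> y") (auto simp: t_def)
    show "t x y = 0 \<longleftrightarrow> x = y" if "x \<in> M" "y \<in> M" for x y
      using pos[of x y] that by (cases "x = y") (auto simp: t_def)
    show "t x y + t z w \<le> max (t x z + t y w) (t x w + t y z)"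
      if "x \<in> M" "y \<in> M" "z \<in> M" "w \<in> M" for x y z w
    proof -
      have tri: "s u w \<le> s u v + s v w" if "u \<in> M" "v \<in> M" "w \<in> M" for u v w
        using s4[of u w v v] s_diag[of v] s_sym[of w v] that by auto
      consider "x = y" | "z = w" | "x = z" | "x = w" | "y = z" | "y = w"
        | "x \<noteq> y" "z \<noteq> w" "x \<noteq> z" "x \<noteq> w" "y \<noteq> z" "y \<noteq> w"
        by blast
      then show ?thesis
      proof cases
        case 1
        then show ?thesis
          using tri[of z x w] s_nonneg[of x z] s_nonneg[of x w] s_sym[of z x] c that
          by (auto simp: t_s)
      next
        case 2
        then show ?thesis
          using tri[of x z y] s_nonneg[of x z] s_nonneg[of z y] s_sym[of z y] c that
          by (auto simp: t_s)
      next
        case 7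
        then show ?thesis
          using s4[OF that] that by (simp add: t_s max_def split: if_splits)
      qed (use sym in auto)
    qed
  qed (use assms sym in auto)
  moreover have "\<bar>d x y - t x y\<bar> \<le> c" if "x \<in> M" "y \<in> M" for x y
  proof (cases "x = y")
    case True
    then show ?thesis
      using c that by (simp add: t_def)
  next
    case False
    then show ?thesis
      using sandwich[of x y] that by (auto simp: t_def gromov_product_def abs_le_iff add_divide_distrib diff_divide_distrib)
  qed
  ultimately show ?thesis
    by blast
qed

end

section \<open>Shortening chains\<close>

text \<open>A chain of length at most \<open>2\<^sup>k\<close> is cut in the middle \<open>k\<close> times, at a loss of \<open>\<delta>\<close> each.\<close>

lemma halving:
  fixes g :: "'b \<Rightarrow> 'b \<Rightarrow> real"
  assumes ultra: "\<And>x y z. x \<in> Y \<Longrightarrow> y \<in> Y \<Longrightarrow> z \<in> Y \<Longrightarrow> g x z \<ge> min (g x y) (g y z) - \<delta>"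
    and "\<delta> \<ge> 0"
    and L: "L \<subseteq> {(u, v). u \<in> Y \<and> v \<in> Y \<and> m \<le> g u v}"
    and "(x, y) \<in> L ^^ n" "1 \<le> n" "n \<le> 2 ^ k"
  shows "g x y \<ge> m - real k * \<delta>"
  using assms(4-6)
proof (induction k arbitrary: n x y)
  case 0
  then have "n = 1"
    by simp
  then show ?case
    using 0 L by auto
next
  case (Suc k)
  show ?case
  proof (cases "n \<le> 2 ^ k")
    case True
    then have "m - real k * \<delta> \<le> g x y"
      using Suc by blast
    then show ?thesis
      using \<open>\<delta> \<ge> 0\<close> by (simp add: algebra_simps)
  next
    case False
    define j where "j = n - 2 ^ k"
    have n: "n = 2 ^ k + j" and j: "1 \<le> j" "j \<le> 2 ^ k"
      using False Suc.prems by (auto simp: j_def)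
    obtain z where z: "(x, z) \<in> L ^^ (2 ^ k)" "(z, y) \<in> L ^^ j"
      using Suc.prems(1) unfolding n relpow_add by blast
    have ge: "m - real k * \<delta> \<le> g x z" "m - real k * \<delta> \<le> g z y"
      using Suc.IH[OF z(1)] Suc.IH[OF z(2)] j by auto
    have in_Y: "u \<in> Y" "v \<in> Y" if "(u, v) \<in> L ^^ i" "i \<ge> 1" for u v i
    proof -
      obtain i' where i': "i = Suc i'"
        using \<open>i \<ge> 1\<close> not0_implies_Suc[of i] by auto
      show "u \<in> Y"
        using relpow_Suc_D2[of u v i' L] that L unfolding i' by blast
      show "v \<in> Y"
        using that L unfolding i' by auto
    qed
    have "g x y \<ge> min (g x z) (g z y) - \<delta>"
      using in_Y[OF z(1)] in_Y[OF z(2)] j by (intro ultra) auto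
    then show ?thesis
      using ge by (simp add: algebra_simps)
  qed
qed

text \<open>Joinability along a single-valued relation (such as passing to the parent in a forest) is an
  equivalence relation. A path of parent steps in either direction and of extra steps \<open>Q\<close> induces
  a path on the classes in which only the extra steps move, so a shortest such path uses each
  element of \<open>Q\<close> at most once.\<close>

lemma rtrancl_single_valued_few_steps:
  fixes T Q :: "('w \<times> 'w) set"
  defines "S \<equiv> T\<^sup>* O (T\<^sup>*)\<inverse>"
  assumes sv: "single_valued T" and "finite Q"
    and xy: "(x, y) \<in> (T \<union> T\<inverse> \<union> Q)\<^sup>*"
  shows "\<exists>n\<le>card Q. (x, y) \<in> S O (Q O S) ^^ n"
proof -
  have "equiv UNIV S"
  proof (rule equivI)
    show "trans S"
    proof (rule transI)
      fix u v w assume "(u, v) \<in> S" "(v, w) \<in> S"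
      then obtain a b where "(u, a) \<in> T\<^sup>*" "(v, a) \<in> T\<^sup>*" "(v, b) \<in> T\<^sup>*" "(w, b) \<in> T\<^sup>*"
        by (auto simp: S_def)
      then show "(u, w) \<in> S"
        using single_valued_confluent[OF sv, of v a b] unfolding S_def
        by (meson converseI relcompI rtrancl_trans)
    qed
  qed (auto simp: S_def refl_on_def sym_def)
  then have S_iff: "S `` {u} = S `` {v} \<longleftrightarrow> (u, v) \<in> S" for u v
    by (simp add: eq_equiv_class_iff)
  define c where "c u = S `` {u}" for u
  define R where "R = map_prod c c ` Q"
  have T_S: "T \<subseteq> S" "T\<inverse> \<subseteq> S"
  proof -
    show "T \<subseteq> S"
      unfolding S_def by (auto intro!: relcompI[OF r_into_rtrancl])
    show "T\<inverse> \<subseteq> S"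
      unfolding S_def by (auto intro!: relcompI[OF rtrancl_refl] r_into_rtrancl)
  qed
  have "(c x, c y) \<in> R\<^sup>*"
    using xy
  proof (induction rule: rtrancl_induct)
    case (step u v)
    show ?case
    proof (cases "(u, v) \<in> Q")
      case True
      then show ?thesis
        using step.IH by (force simp: R_def intro: rtrancl.rtrancl_into_rtrancl)
    next
      case False
      then have "c u = c v"
        using step.hyps T_S S_iff by (auto simp: c_def)
      then show ?thesis
        using step.IH by simp
    qed
  qed simp
  moreover have fin: "finite R" "card R \<le> card Q"
    using \<open>finite Q\<close> by (auto simp: R_def card_image_le)
  ultimately obtain n where n: "n \<le> card R" "(c x, c y) \<in> R ^^ n"
    using rtrancl_finite_eq_relpow[of R] by auto
  have "(x, v) \<in> S O (Q O S) ^^ n" if "(c x, c v) \<in> R ^^ n" for v n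
    using that
  proof (induction n arbitrary: v)
    case 0
    then show ?case
      using S_iff by (auto simp: c_def)
  next
    case (Suc n)
    then obtain a b where "(c x, c a) \<in> R ^^ n" and ab: "(a, b) \<in> Q" "c v = c b"
      unfolding R_def by auto
    then have "(x, a) \<in> S O (Q O S) ^^ n"
      using Suc.IH by blast
    moreover have "(b, v) \<in> S"
      using ab(2) S_iff[of b v] by (simp add: c_def)
    ultimately show ?case
      using ab by auto
  qed
  then show ?thesis
    using n fin by (meson order_trans)
qed

text \<open>Moving within a class takes one link and an extra step takes two.\<close>

lemma few_steps_to_links:
  assumes SL: "\<And>u v. u \<in> A \<Longrightarrow> (u, v) \<in> S \<Longrightarrow> (u, v) \<in> L"
    and QL: "\<And>u v. (u, v) \<in> Q \<Longrightarrow> v \<in> A \<and> (u, v) \<in> L O L"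
    and "x \<in> A" "(x, y) \<in> S O (Q O S) ^^ n"
  shows "(x, y) \<in> L ^^ (3 * n + 1)"
proof -
  have "Q O S \<subseteq> L ^^ 3"
  proof clarify
    fix a b c assume "(a, b) \<in> Q" "(b, c) \<in> S"
    then show "(a, c) \<in> L ^^ 3"
      using QL[of a b] SL[of b c] by (auto simp: numeral_3_eq_3)
  qed
  then have "(Q O S) ^^ n \<subseteq> L ^^ (3 * n)"
  proof (induction n)
    case (Suc n)
    then have "(Q O S) ^^ n O (Q O S) \<subseteq> L ^^ (3 * n) O L ^^ 3"
      using \<open>Q O S \<subseteq> L ^^ 3\<close> by (intro relcomp_mono)
    also have "\<dots> = L ^^ (3 * n + 3)"
      by (rule relpow_add[symmetric])
    finally show ?case
      by (simp only: relpow.simps mult_Suc_right add.commute[of 3])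
  qed simp
  then have "(x, y) \<in> L O L ^^ (3 * n)"
    using SL assms(3,4) by blast
  then show ?thesis
    by (simp add: relpow_commute)
qed

section \<open>The shortest-path metric of a realization\<close>

definition edge_point :: "('v::linorder) mgraph \<Rightarrow> 'v set \<Rightarrow> real \<Rightarrow> 'v gpoint" where
  "edge_point G e s =
     (if s = 0 then Vertex (Min e) else if s = len G e then Vertex (Max e) else Inner e s)"

locale connected_metric_graph =
  fixes G :: "('v::linorder) mgraph"
  assumes graph: "metric_graph G"
begin

abbreviation E where "E \<equiv> edges G"
abbreviation P where "P \<equiv> realization G"
abbreviation D where "D \<equiv> path_dist G"
abbreviation pt where "pt \<equiv> edge_point G"

lemma finite_verts: "finite (verts G)"
  and verts_nonempty: "verts G \<noteq> {}"
  and edge_verts: "e \<in> E \<Longrightarrow> e \<subseteq> verts G"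
  and card_edge: "e \<in> E \<Longrightarrow> card e = 2"
  and len_pos: "e \<in> E \<Longrightarrow> len G e > 0"
  and connected: "u \<in> verts G \<Longrightarrow> v \<in> verts G \<Longrightarrow> (u, v) \<in> {(a, b). {a, b} \<in> E}\<^sup>*"
  using graph by (auto simp: metric_graph_def)

lemma finite_edges: "finite E"
  by (rule finite_subset[of _ "Pow (verts G)"]) (use edge_verts finite_verts in auto)

lemma edge_ends:
  assumes "e \<in> E"
  shows "Min e < Max e" "Min e \<in> verts G" "Max e \<in> verts G" "e = {Min e, Max e}"
proof -
  obtain a b where e: "e = {a, b}" "a \<noteq> b"
    using card_edge[OF assms] by (auto simp: card_2_iff)
  then show "Min e < Max e" "e = {Min e, Max e}"
    by (auto simp: min_def max_def)
  show "Min e \<in> verts G" "Max e \<in> verts G"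
    using edge_verts[OF assms] e by (auto simp: min_def max_def)
qed

lemma edge_coord_iff:
  "edge_coord G e q s \<longleftrightarrow> e \<in> E \<and> 0 \<le> s \<and> s \<le> len G e \<and> q = pt e s"
proof
  show "edge_coord G e q s \<Longrightarrow> e \<in> E \<and> 0 \<le> s \<and> s \<le> len G e \<and> q = pt e s"
    by (induction rule: edge_coord.cases) (auto simp: edge_point_def less_imp_le dest: len_pos)
  show "e \<in> E \<and> 0 \<le> s \<and> s \<le> len G e \<and> q = pt e s \<Longrightarrow> edge_coord G e q s"
    by (auto simp: edge_point_def intro: edge_coord.intros)
qed

lemma edge_point_in_realization: "e \<in> E \<Longrightarrow> 0 \<le> s \<Longrightarrow> s \<le> len G e \<Longrightarrow> pt e s \<in> P"
  using edge_ends[of e] by (auto simp: edge_point_def realization_def)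

lemma edge_point_inject:
  assumes "e \<in> E" "pt e s = pt e s'"
  shows "s = s'"
  using assms edge_ends(1)[of e] len_pos[of e] by (auto simp: edge_point_def split: if_splits)

lemma edge_point_unique_edge:
  assumes "pt e s = pt e' s'" "pt e s \<notin> range Vertex"
  shows "e = e'"
  using assms by (auto simp: edge_point_def split: if_splits)

lemma realization_cases:
  assumes "q \<in> P"
  obtains v where "v \<in> verts G" "q = Vertex v"
  | e s where "e \<in> E" "0 < s" "s < len G e" "q = pt e s" "q = Inner e s"
  using assms by (auto simp: realization_def edge_point_def)

lemma path_length_realization:
  "path_length G p q a \<Longrightarrow> p \<in> P \<and> q \<in> P \<and> a \<ge> 0"
  by (induction rule: path_length.induct) (auto simp: edge_coord_iff edge_point_in_realization)

lemma path_length_edge: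
  assumes "e \<in> E" "0 \<le> s" "s \<le> len G e" "0 \<le> s'" "s' \<le> len G e"
  shows "path_length G (pt e s) (pt e s') \<bar>s - s'\<bar>"
  using path_length.step[OF path_length.refl[OF edge_point_in_realization], of e s e s "pt e s'" s']
    assms by (simp add: edge_coord_iff)

lemma path_length_trans:
  assumes "path_length G q r b" "path_length G p q a"
  shows "path_length G p r (a + b)"
  using assms
proof (induction rule: path_length.induct)
  case (step q r b e s t s')
  then show ?case
    using path_length.step[of G p r "a + b" e s t s'] by (simp add: add.assoc)
qed simp

lemma path_length_sym: "path_length G p q a \<Longrightarrow> path_length G q p a"
proof (induction rule: path_length.induct)
  case (step p q a e s r s')
  then have "path_length G r q \<bar>s' - s\<bar>"
    using path_length_edge[of e s' s] by (simp add: edge_coord_iff)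
  then have "path_length G r p (\<bar>s' - s\<bar> + a)"
    using path_length_trans step.IH by blast
  then show ?case
    by (simp add: add.commute abs_minus_commute)
qed (rule path_length.refl)

lemma path_exists:
  assumes "p \<in> P" "q \<in> P"
  shows "\<exists>a. path_length G p q a"
proof -
  have to_vertex: "\<exists>v\<in>verts G. \<exists>a. path_length G r (Vertex v) a" if "r \<in> P" for r
    using that
  proof (cases rule: realization_cases)
    case (1 v)
    then show ?thesis
      using path_length.refl[OF that] by blast
  next
    case (2 e s)
    then show ?thesis
      using path_length_edge[of e s 0] edge_ends[of e] by (auto simp: edge_point_def)
  qed
  have "\<exists>a. path_length G (Vertex u) (Vertex v) a" if "u \<in> verts G" "v \<in> verts G" for u v
    using connected[OF that]
  proof (induction rule: rtrancl_induct)
    case base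
    then show ?case
      using path_length.refl[of "Vertex u" G] that by (auto simp: realization_def)
  next
    case (step v w)
    define e where "e = {v, w}"
    have e: "e \<in> E"
      using step.hyps by (simp add: e_def)
    have pts: "pt e 0 = Vertex (Min e)" "pt e (len G e) = Vertex (Max e)"
      using len_pos[OF e] by (auto simp: edge_point_def)
    have "\<exists>a. path_length G (Vertex v) (Vertex w) a"
    proof (cases "v \<le> w")
      case True
      then have "Min e = v" "Max e = w"
        by (auto simp: e_def min_def max_def)
      then show ?thesis
        using path_length_edge[OF e, of 0 "len G e"] len_pos[OF e] pts by auto
    next
      case False
      then have "Min e = w" "Max e = v"
        by (auto simp: e_def min_def max_def)
      then show ?thesis
        using path_length_edge[OF e, of "len G e" 0] len_pos[OF e] pts by auto
    qed
    then show ?case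
      using step.IH path_length_trans by blast
  qed
  then show ?thesis
    using to_vertex[OF assms(1)] to_vertex[OF assms(2)]
    by (meson path_length_sym path_length_trans)
qed

lemma path_dist_le: "path_length G p q a \<Longrightarrow> D p q \<le> a"
  unfolding path_dist_def
  by (rule cInf_lower) (auto intro: bdd_belowI[of _ 0] dest: path_length_realization)

lemma path_dist_greatest:
  assumes "p \<in> P" "q \<in> P" "\<And>a. path_length G p q a \<Longrightarrow> b \<le> a"
  shows "b \<le> D p q"
  unfolding path_dist_def by (rule cInf_greatest) (use assms path_exists in auto)

lemma path_dist_nonneg: "p \<in> P \<Longrightarrow> q \<in> P \<Longrightarrow> 0 \<le> D p q"
  by (rule path_dist_greatest) (auto dest: path_length_realization)

lemma path_dist_self: "p \<in> P \<Longrightarrow> D p p = 0"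
  using path_dist_le[OF path_length.refl] path_dist_nonneg by (simp add: order_antisym)

lemma path_dist_sym: "D p q = D q p"
proof -
  have "{a. path_length G p q a} = {a. path_length G q p a}"
    using path_length_sym by blast
  then show ?thesis
    by (simp add: path_dist_def)
qed

lemma path_dist_approx:
  assumes "p \<in> P" "q \<in> P" "\<epsilon> > 0"
  obtains a where "path_length G p q a" "a < D p q + \<epsilon>"
proof -
  have "\<exists>a. path_length G p q a \<and> a < D p q + \<epsilon>"
    using path_dist_greatest[OF assms(1,2), of "D p q + \<epsilon>"] \<open>\<epsilon> > 0\<close> by force
  then show ?thesis
    using that by blast
qed

lemma path_dist_triangle:
  assumes "p \<in> P" "q \<in> P" "r \<in> P"
  shows "D p r \<le> D p q + D q r"
proof (rule field_le_epsilon)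
  fix \<epsilon> :: real assume "\<epsilon> > 0"
  then obtain a b where ab: "path_length G p q a" "a < D p q + \<epsilon> / 2"
      "path_length G q r b" "b < D q r + \<epsilon> / 2"
    using path_dist_approx[of p q "\<epsilon> / 2"] path_dist_approx[of q r "\<epsilon> / 2"] assms
    by (metis half_gt_zero)
  then have "D p r \<le> a + b"
    using path_length_trans by (intro path_dist_le) blast
  then show "D p r \<le> D p q + D q r + \<epsilon>"
    using ab by linarith
qed

lemma path_dist_edge:
  assumes "e \<in> E" "0 \<le> s" "s \<le> len G e" "0 \<le> s'" "s' \<le> len G e"
  shows "D (pt e s) (pt e s') \<le> \<bar>s - s'\<bar>"
  using path_length_edge[OF assms] by (rule path_dist_le)

lemma path_dist_lipschitz:
  assumes "p \<in> P" "e \<in> E" "0 \<le> s" "s \<le> len G e" "0 \<le> s'" "s' \<le> len G e"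
  shows "D p (pt e s) \<le> D p (pt e s') + \<bar>s - s'\<bar>"
  using path_dist_triangle[of p "pt e s'" "pt e s"] path_dist_edge[of e s' s] assms
  by (simp add: edge_point_in_realization abs_minus_commute)

lemma path_dist_bounded: "\<exists>B. \<forall>x\<in>P. \<forall>y\<in>P. \<bar>D x y\<bar> \<le> B"
proof -
  obtain v0 where "v0 \<in> verts G"
    using verts_nonempty by blast
  define o0 where "o0 = Vertex v0"
  have o0: "o0 \<in> P"
    using \<open>v0 \<in> verts G\<close> by (simp add: o0_def realization_def)
  have vert: "Vertex v \<in> P" if "v \<in> verts G" for v
    using that by (simp add: realization_def)
  define B where "B = (\<Sum>v\<in>verts G. D o0 (Vertex v)) + (\<Sum>e\<in>E. len G e)"
  have sums: "(\<Sum>e\<in>E. len G e) \<ge> 0" "e \<in> E \<Longrightarrow> len G e \<le> (\<Sum>e\<in>E. len G e)"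
    "v \<in> verts G \<Longrightarrow> D o0 (Vertex v) \<le> (\<Sum>v\<in>verts G. D o0 (Vertex v))" for e v
    using len_pos finite_edges finite_verts path_dist_nonneg[OF o0 vert]
    by (auto intro!: sum_nonneg member_le_sum simp: less_imp_le)
  have near: "D o0 x \<le> B" if "x \<in> P" for x
    using that
  proof (cases rule: realization_cases)
    case (1 v)
    then show ?thesis
      using sums(1) sums(3)[of v] by (simp add: B_def)
  next
    case (2 e s)
    then have "D o0 x \<le> D o0 (pt e 0) + s"
      using path_dist_lipschitz[OF o0, of e s 0] by simp
    also have "pt e 0 = Vertex (Min e)"
      by (simp add: edge_point_def)
    finally show ?thesis
      using sums(2)[of e] sums(3)[of "Min e"] edge_ends[of e] 2 by (simp add: B_def)
  qed
  have "\<bar>D x y\<bar> \<le> 2 * B" if "x \<in> P" "y \<in> P" for x y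
    using path_dist_triangle[of x o0 y] path_dist_nonneg[of x y] path_dist_sym[of x o0] o0 that
      near[of x] near[of y] by linarith
  then show ?thesis
    by blast
qed

lemma graph_hyp_nonneg: "graph_hyp G \<ge> 0"
  and gromov_product_ge_minus_graph_hyp:
    "p \<in> P \<Longrightarrow> x \<in> P \<Longrightarrow> y \<in> P \<Longrightarrow> z \<in> P \<Longrightarrow> gromov_product D p x z
      \<ge> min (gromov_product D p x y) (gromov_product D p y z) - graph_hyp G"
proof -
  obtain B where B: "\<And>x y. x \<in> P \<Longrightarrow> y \<in> P \<Longrightarrow> \<bar>D x y\<bar> \<le> B"
    using path_dist_bounded by blast
  have ne: "P \<noteq> {}"
    using verts_nonempty by (auto simp: realization_def)
  show "graph_hyp G \<ge> 0"
    unfolding graph_hyp_def using ne B by (rule hyp_nonneg)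
  show "p \<in> P \<Longrightarrow> x \<in> P \<Longrightarrow> y \<in> P \<Longrightarrow> z \<in> P \<Longrightarrow> gromov_product D p x z
      \<ge> min (gromov_product D p x y) (gromov_product D p y z) - graph_hyp G"
    unfolding graph_hyp_def using ne B by (rule gromov_product_ge_minus_hyp)
qed

end

section \<open>Walks between marked points\<close>

text \<open>The marked points subdivide the realization into a finite combinatorial graph. Its edges,
  called segments, are the pieces of edges of \<open>G\<close> between consecutive marked points; \<open>(e, s)\<close> stands
  for the segment of \<open>e\<close> that begins at coordinate \<open>s\<close>.\<close>

locale marked_metric_graph = connected_metric_graph G for G :: "('v::linorder) mgraph" +
  fixes W :: "'v gpoint set" and p :: "'v gpoint"
  assumes finite_marked: "finite W"
    and verts_marked: "Vertex ` verts G \<subseteq> W"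
    and marked_subset: "W \<subseteq> P"
    and base_marked: "p \<in> W"
begin

abbreviation h where "h \<equiv> D p"

definition coords :: "'v set \<Rightarrow> real set" where
  "coords e = {s. 0 \<le> s \<and> s \<le> len G e \<and> pt e s \<in> W}"

definition next_coord :: "'v set \<Rightarrow> real \<Rightarrow> real" where
  "next_coord e s = Min {s' \<in> coords e. s < s'}"

definition segments :: "('v set \<times> real) set" where
  "segments = {(e, s). e \<in> E \<and> s \<in> coords e \<and> s < len G e}"

definition lower :: "'v set \<times> real \<Rightarrow> 'v gpoint" where
  "lower i = pt (fst i) (snd i)"

definition upper :: "'v set \<times> real \<Rightarrow> 'v gpoint" where
  "upper i = pt (fst i) (next_coord (fst i) (snd i))"

definition gap :: "'v set \<times> real \<Rightarrow> real" where
  "gap i = next_coord (fst i) (snd i) - snd i"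

lemma finite_coords:
  assumes "e \<in> E"
  shows "finite (coords e)"
proof (rule finite_imageD)
  show "finite (pt e ` coords e)"
    by (rule finite_subset[OF _ finite_marked]) (auto simp: coords_def)
  show "inj_on (pt e) (coords e)"
    using edge_point_inject[OF assms] by (auto simp: inj_on_def)
qed

lemma ends_in_coords: "e \<in> E \<Longrightarrow> 0 \<in> coords e" "e \<in> E \<Longrightarrow> len G e \<in> coords e"
  using verts_marked edge_ends[of e] len_pos[of e] by (auto simp: coords_def edge_point_def)

lemma next_coord:
  assumes "e \<in> E" "s < len G e"
  shows "next_coord e s \<in> coords e" "s < next_coord e s"
    "\<And>t. t \<in> coords e \<Longrightarrow> s < t \<Longrightarrow> next_coord e s \<le> t"
proof -
  have fin: "finite {s' \<in> coords e. s < s'}"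
    using finite_coords[OF assms(1)] by simp
  have "{s' \<in> coords e. s < s'} \<noteq> {}"
    using ends_in_coords(2)[OF assms(1)] assms(2) by blast
  then show "next_coord e s \<in> coords e" "s < next_coord e s"
    using Min_in[OF fin] by (auto simp: next_coord_def)
  show "next_coord e s \<le> t" if "t \<in> coords e" "s < t" for t
    unfolding next_coord_def using fin that by (intro Min_le) auto
qed

lemma segment_ends:
  assumes "i \<in> segments"
  shows "lower i \<in> W" "upper i \<in> W" "lower i \<noteq> upper i" "0 < gap i"
    "D (lower i) (upper i) \<le> gap i" "D (upper i) (lower i) \<le> gap i"
proof -
  obtain e s where i: "i = (e, s)" "e \<in> E" "s \<in> coords e" "s < len G e"
    using assms by (auto simp: segments_def)
  note n = next_coord[OF i(2,4)]
  show "lower i \<in> W" "upper i \<in> W" "0 < gap i"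
    using i n by (auto simp: lower_def upper_def gap_def coords_def)
  show "lower i \<noteq> upper i"
    using n(2) edge_point_inject[OF i(2), of s "next_coord e s"]
    by (auto simp: lower_def upper_def i)
  show "D (lower i) (upper i) \<le> gap i" "D (upper i) (lower i) \<le> gap i"
    using n i path_dist_edge[of e s "next_coord e s"] path_dist_edge[of e "next_coord e s" s]
    by (auto simp: lower_def upper_def gap_def coords_def)
qed

text \<open>Every segment is named by its lower end: these are the starting vertices of all edges,
  together with the marked points that are not vertices. Marking points thus adds equally many
  points and segments, as it must for the Betti number to stay unchanged.\<close>

lemma card_segments: "finite segments" "card segments + card (verts G) = card E + card W"
proof -
  define J where "J = {(e, s). Inner e s \<in> W}"
  have J: "(e, s) \<in> J \<Longrightarrow> e \<in> E \<and> 0 < s \<and> s < len G e" for e s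
    using marked_subset by (auto simp: J_def realization_def)
  have seg: "segments = (\<lambda>e. (e, 0)) ` E \<union> J"
  proof (intro set_eqI iffI)
    fix i assume "i \<in> segments"
    then show "i \<in> (\<lambda>e. (e, 0)) ` E \<union> J"
      by (auto simp: segments_def coords_def J_def edge_point_def split: if_splits)
  next
    fix i assume "i \<in> (\<lambda>e. (e, 0)) ` E \<union> J"
    then show "i \<in> segments"
    proof
      assume "i \<in> (\<lambda>e. (e, 0)) ` E"
      then show ?thesis
        using ends_in_coords(1) len_pos by (auto simp: segments_def)
    next
      assume "i \<in> J"
      moreover obtain e s where "i = (e, s)"
        by fastforce
      ultimately show ?thesis
        using J[of e s] by (auto simp: segments_def coords_def J_def edge_point_def)
    qed
  qed
  have bij: "bij_betw (\<lambda>(e, s). Inner e s) J (W - Vertex ` verts G)"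
    using marked_subset by (force simp: bij_betw_def inj_on_def J_def realization_def)
  have finJ: "finite J"
    using bij_betw_finite[OF bij] finite_marked by simp
  then show "finite segments"
    using seg finite_edges by simp
  have "card J = card W - card (verts G)"
    using bij_betw_same_card[OF bij] verts_marked finite_verts
    by (simp add: card_Diff_subset card_image inj_on_def)
  moreover have "card (verts G) \<le> card W"
    using card_mono[OF finite_marked verts_marked] by (simp add: card_image inj_on_def)
  moreover have "card segments = card ((\<lambda>e. (e, 0::real)) ` E) + card J"
    unfolding seg using finJ finite_edges J by (intro card_Un_disjoint) auto
  moreover have "card ((\<lambda>e. (e, 0::real)) ` E) = card E"
    by (simp add: card_image inj_on_def)
  ultimately show "card segments + card (verts G) = card E + card W"
    by linarith
qed

definition adjacent :: "'v gpoint \<Rightarrow> 'v gpoint \<Rightarrow> real \<Rightarrow> bool" where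
  "adjacent q r l \<longleftrightarrow> (\<exists>i\<in>segments. l = gap i \<and>
     (q = lower i \<and> r = upper i \<or> q = upper i \<and> r = lower i))"

lemma adjacent_dist: "adjacent q r l \<Longrightarrow> q \<in> W \<and> r \<in> W \<and> D q r \<le> l"
  by (auto simp: adjacent_def segment_ends)

inductive walk :: "'v gpoint \<Rightarrow> 'v gpoint \<Rightarrow> real \<Rightarrow> bool" for q where
  refl: "q \<in> W \<Longrightarrow> walk q q 0"
| step: "walk q r c \<Longrightarrow> adjacent r r' l \<Longrightarrow> walk q r' (c + l)"

lemma walk_dist: "walk q r c \<Longrightarrow> q \<in> W \<and> r \<in> W \<and> D q r \<le> c"
proof (induction rule: walk.induct)
  case refl
  then show ?case
    using path_dist_self marked_subset by auto
next
  case (step r c r' l)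
  then show ?case
    using adjacent_dist[of r r' l] path_dist_triangle[of q r r'] marked_subset by fastforce
qed

lemma walk_along_edge:
  assumes "e \<in> E" "s \<in> coords e" "t \<in> coords e" "walk q (pt e s) c"
  shows "walk q (pt e t) (c + \<bar>s - t\<bar>)"
proof -
  have both: "(walk q (pt e a) c \<longrightarrow> walk q (pt e b) (c + (b - a))) \<and>
        (walk q (pt e b) c \<longrightarrow> walk q (pt e a) (c + (b - a)))"
    if "a \<in> coords e" "b \<in> coords e" "a \<le> b" for a b c
    using that
  proof (induction "card {t \<in> coords e. a < t \<and> t \<le> b}" arbitrary: a c rule: less_induct)
    case less
    show ?case
    proof (cases "a = b")
      case False
      then have ab: "a < b" "b \<le> len G e"
        using less.prems by (auto simp: coords_def)
      define n where "n = next_coord e a"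
      have n: "n \<in> coords e" "a < n" "n \<le> b"
        using next_coord[OF \<open>e \<in> E\<close>, of a] ab less.prems by (auto simp: n_def)
      have "(e, a) \<in> segments"
        using \<open>e \<in> E\<close> less.prems ab by (simp add: segments_def)
      moreover have "lower (e, a) = pt e a" "upper (e, a) = pt e n" "gap (e, a) = n - a"
        by (auto simp: lower_def upper_def gap_def n_def)
      ultimately have "adjacent (pt e a) (pt e n) (n - a)" "adjacent (pt e n) (pt e a) (n - a)"
        unfolding adjacent_def by metis+
      note steps = walk.step[OF _ this(1)] walk.step[OF _ this(2)]
      have "{t \<in> coords e. n < t \<and> t \<le> b} \<subset> {t \<in> coords e. a < t \<and> t \<le> b}"
        using n by (auto simp: psubset_eq)
      then have "card {t \<in> coords e. n < t \<and> t \<le> b} < card {t \<in> coords e. a < t \<and> t \<le> b}"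
        using finite_coords[OF \<open>e \<in> E\<close>] by (intro psubset_card_mono) auto
      note IH = less.hyps[OF this n(1) less.prems(2) n(3)]
      show ?thesis
        using steps(1)[of q c] steps(2)[of q "c + (b - n)"] IH[of c] IH[of "c + (n - a)"]
        by simp
    qed simp
  qed
  show ?thesis
    using both[of s t c] both[of t s c] assms by (cases "s \<le> t") auto
qed

text \<open>A path may leave an edge only through a vertex, which is marked. Hence it can be traced by a
  walk that always ends at a marked point of the current edge and has already covered the remaining
  stretch to that point.\<close>

lemma walk_of_path_aux:
  assumes "path_length G q r c" "q \<in> W" "e \<in> E" "0 \<le> s" "s \<le> len G e" "r = pt e s" "w \<in> coords e"
  shows "\<exists>c'\<le>c + \<bar>s - w\<bar>. walk q (pt e w) c'"
  using assms
proof (induction arbitrary: e s w rule: path_length.induct)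
  case (refl q)
  then have "walk q (pt e w) (0 + \<bar>s - w\<bar>)"
    by (intro walk_along_edge) (auto simp: coords_def intro: walk.refl)
  then show ?case
    by auto
next
  case (step q r' c f s1 r s2)
  have f: "f \<in> E" "0 \<le> s1" "s1 \<le> len G f" "r' = pt f s1" "0 \<le> s2" "s2 \<le> len G f" "r = pt f s2"
    using step.hyps by (auto simp: edge_coord_iff)
  show ?case
  proof (cases "r \<in> range Vertex")
    case True
    then have "r \<in> W"
      using edge_point_in_realization[of f s2] f verts_marked by (auto simp: realization_def)
    then obtain c' where c': "c' \<le> c + \<bar>s1 - s2\<bar>" "walk q (pt f s2) c'"
      using step.IH[of f s1 s2] step.prems(1) f by (auto simp: coords_def)
    have "walk q (pt e w) (c' + \<bar>s - w\<bar>)"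
      using c' f step.prems \<open>r \<in> W\<close> by (intro walk_along_edge) (auto simp: coords_def)
    then show ?thesis
      using c'(1) by (intro exI[of _ "c' + \<bar>s - w\<bar>"]) auto
  next
    case False
    then have e: "e = f"
      using edge_point_unique_edge[of e s f s2] step.prems f by auto
    then have "s = s2"
      using edge_point_inject[of f s s2] step.prems f by auto
    obtain c' where "c' \<le> c + \<bar>s1 - w\<bar>" "walk q (pt e w) c'"
      using step.IH[of e s1 w] step.prems f e by auto
    then show ?thesis
      using \<open>s = s2\<close> by (intro exI[of _ c']) auto
  qed
qed

lemma walk_of_path:
  assumes "path_length G q r c" "q \<in> W" "r \<in> W"
  shows "\<exists>c'\<le>c. walk q r c'"
  using assms(1)
proof cases
  case refl
  then show ?thesis
    using walk.refl[OF assms(2)] by auto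
next
  case (step r' a e s t)
  then have e: "e \<in> E" "0 \<le> t" "t \<le> len G e" "r = pt e t"
    by (auto simp: edge_coord_iff)
  then show ?thesis
    using walk_of_path_aux[OF assms(1,2) e, of t] assms(3) by (auto simp: coords_def)
qed

definition links :: "real \<Rightarrow> ('v gpoint \<times> 'v gpoint) set" where
  "links m = {(u, v). u \<in> P \<and> v \<in> P \<and> m \<le> gromov_product D p u v}"

definition above :: "real \<Rightarrow> 'v gpoint set" where
  "above m = {q \<in> W. m \<le> h q}"

definition steps_above :: "real \<Rightarrow> ('v gpoint \<times> 'v gpoint) set" where
  "steps_above m = {(q, r). q \<in> above m \<and> r \<in> above m \<and> (\<exists>l. adjacent q r l)}"

text \<open>Geodesics are replaced by walks of almost minimal length, which is why the product has to
  exceed \<open>m\<close> strictly. Along a geodesic from \<open>u\<close> to \<open>v\<close>, adding the two triangle inequalities at a point shows that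
  its distance to \<open>p\<close> is at least the Gromov product of \<open>u\<close> and \<open>v\<close>.\<close>

lemma steps_above_of_product:
  assumes "u \<in> W" "v \<in> W" "m < gromov_product D p u v"
  shows "u \<in> above m" "(u, v) \<in> (steps_above m)\<^sup>*"
proof -
  have P: "u \<in> P" "v \<in> P" "p \<in> P"
    using assms marked_subset base_marked by auto
  define \<epsilon> where "\<epsilon> = gromov_product D p u v - m"
  have "\<epsilon> > 0"
    using assms by (simp add: \<epsilon>_def)
  define K where "K = D u v + \<epsilon>"
  have high: "q \<in> above m" if "walk u q c" "c + D q v \<le> K" for q c
  proof -
    have q: "q \<in> W" "q \<in> P" "D u q \<le> c"
      using walk_dist[OF that(1)] marked_subset by auto
    have "h u \<le> h q + D u q" "h v \<le> h q + D q v"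
      using path_dist_triangle[of p q u] path_dist_triangle[of p q v] path_dist_sym[of q u] P q
      by auto
    then have "2 * h q \<ge> h u + h v - K"
      using q that by linarith
    also have "h u + h v - K = 2 * m + \<epsilon>"
      by (simp add: K_def \<epsilon>_def gromov_product_def field_simps)
    finally show ?thesis
      using q \<open>\<epsilon> > 0\<close> by (simp add: above_def)
  qed
  have reach: "(u, q) \<in> (steps_above m)\<^sup>*" if "walk u q c" "c + D q v \<le> K" for q c
    using that
  proof (induction rule: walk.induct)
    case (step q c r l)
    have "D q v \<le> l + D r v"
      using adjacent_dist[OF step.hyps(2)] path_dist_triangle[of q r v] marked_subset P by fastforce
    then have c: "c + D q v \<le> K"
      using step.prems by linarith
    have "q \<in> above m" "r \<in> above m"
      using high step.hyps(1) c high[OF walk.step[OF step.hyps] step.prems] by auto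
    then have "(q, r) \<in> steps_above m"
      using step.hyps(2) by (auto simp: steps_above_def)
    then show ?case
      using step.IH[OF c] by simp
  qed simp
  show "u \<in> above m"
    using high[OF walk.refl[OF assms(1)]] \<open>\<epsilon> > 0\<close> by (simp add: K_def)
  obtain a where a: "path_length G u v a" "a < K"
    using path_dist_approx[OF P(1,2) \<open>\<epsilon> > 0\<close>] unfolding K_def by blast
  obtain c where "c \<le> a" "walk u v c"
    using walk_of_path[OF a(1) assms(1,2)] by blast
  then show "(u, v) \<in> (steps_above m)\<^sup>*"
    using reach[of v c] a(2) path_dist_self[OF P(2)] by simp
qed

end

section \<open>The shortest-path forest and the remaining segments\<close>

context marked_metric_graph
begin

definition descends :: "'v gpoint \<Rightarrow> 'v set \<times> real \<Rightarrow> 'v gpoint \<Rightarrow> bool" where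
  "descends q i r \<longleftrightarrow> i \<in> segments \<and> {q, r} = {lower i, upper i} \<and> q \<noteq> r \<and> h r + gap i \<le> h q"

text \<open>Walks from \<open>p\<close> to \<open>q\<close> of almost minimal length end with a segment along which the height grows
  almost by its length. As there are finitely many segments at \<open>q\<close>, one of them meets the
  requirement exactly.\<close>

lemma descends_exists:
  assumes "q \<in> W" "q \<noteq> p"
  shows "\<exists>i r. descends q i r"
proof -
  have P: "q \<in> P" "p \<in> P"
    using assms marked_subset base_marked by auto
  define F where "F = (\<lambda>i. h (lower i) + gap i - h (upper i)) ` {i \<in> segments. upper i = q} \<union>
    (\<lambda>i. h (upper i) + gap i - h (lower i)) ` {i \<in> segments. lower i = q}"
  have fin: "finite F"
    using card_segments(1) by (simp add: F_def)
  have small: "\<exists>x\<in>F. x < \<epsilon>" if eps: "\<epsilon> > 0" for \<epsilon>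
  proof -
    obtain a where a: "path_length G p q a" "a < h q + \<epsilon>"
      using path_dist_approx[OF P(2,1) eps] by blast
    obtain c where c: "c \<le> a" "walk p q c"
      using walk_of_path[OF a(1) base_marked assms(1)] by blast
    from c(2) show ?thesis
    proof cases
      case (step r b l)
      have "h r + l - h q < \<epsilon>"
        using walk_dist[OF step(2)] step(1) c(1) a(2) by linarith
      moreover have "h r + l - h q \<in> F"
        using step(3) unfolding adjacent_def F_def by auto
      ultimately show ?thesis
        by blast
    qed (use assms in simp)
  qed
  have "F \<noteq> {}"
    using small[of 1] by auto
  have "Min F \<le> 0"
    using small[of "Min F"] fin by (meson Min_le not_less)
  then have "\<exists>x\<in>F. x \<le> 0"
    using Min_in[OF fin \<open>F \<noteq> {}\<close>] by blast
  then consider i where "i \<in> segments" "upper i = q" "h (lower i) + gap i \<le> h q"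
    | i where "i \<in> segments" "lower i = q" "h (upper i) + gap i \<le> h q"
    by (auto simp: F_def)
  then show ?thesis
  proof cases
    case 1
    then have "descends q i (lower i)"
      using segment_ends(3)[of i] by (auto simp: descends_def)
    then show ?thesis
      by blast
  next
    case 2
    then have "descends q i (upper i)"
      using segment_ends(3)[of i] by (auto simp: descends_def)
    then show ?thesis
      by blast
  qed
qed

definition parent_segment :: "'v gpoint \<Rightarrow> 'v set \<times> real" where
  "parent_segment q = (SOME i. \<exists>r. descends q i r)"

definition parent :: "'v gpoint \<Rightarrow> 'v gpoint" where
  "parent q = (SOME r. descends q (parent_segment q) r)"

lemma descends_parent:
  assumes "q \<in> W" "q \<noteq> p"
  shows "descends q (parent_segment q) (parent q)"
proof -
  have "\<exists>r. descends q (parent_segment q) r"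
    unfolding parent_segment_def using descends_exists[OF assms] by (rule someI_ex)
  then show ?thesis
    unfolding parent_def by (rule someI_ex)
qed

definition extra_segments :: "('v set \<times> real) set" where
  "extra_segments = segments - parent_segment ` (W - {p})"

text \<open>A segment cannot be a descent from both of its ends, so different points have different
  parent segments.\<close>

lemma card_extra_segments: "int (card extra_segments) = betti1 G"
proof -
  have "inj_on parent_segment (W - {p})"
  proof (rule inj_onI, rule ccontr)
    fix q r assume qr: "q \<in> W - {p}" "r \<in> W - {p}" "parent_segment q = parent_segment r" "q \<noteq> r"
    have "descends q (parent_segment q) (parent q)" "descends r (parent_segment q) (parent r)"
      using descends_parent[of q] descends_parent[of r] qr by auto
    moreover from this have "parent q = r" "parent r = q"
      using qr(4) unfolding descends_def by (metis doubleton_eq_iff)+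
    ultimately show False
      using segment_ends(4)[of "parent_segment q"] by (auto simp: descends_def)
  qed
  then have "card (parent_segment ` (W - {p})) = card W - 1"
    using base_marked finite_marked by (simp add: card_image)
  moreover have "parent_segment ` (W - {p}) \<subseteq> segments"
    using descends_parent by (force simp: descends_def)
  moreover have "card W \<ge> 1"
    using base_marked finite_marked by (metis One_nat_def Suc_leI card_gt_0_iff empty_iff)
  ultimately have "card extra_segments + card W = card segments + 1"
    using card_segments(1) card_mono[of segments "parent_segment ` (W - {p})"] finite_marked
    unfolding extra_segments_def by (simp add: card_Diff_subset)
  then show ?thesis
    using card_segments(2) by (simp add: betti1_def)
qed

definition parent_steps :: "real \<Rightarrow> ('v gpoint \<times> 'v gpoint) set" where
  "parent_steps m = {(q, parent q) | q. q \<in> W \<and> q \<noteq> p \<and> m \<le> h (parent q)}"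

definition extra_steps :: "real \<Rightarrow> ('v gpoint \<times> 'v gpoint) set" where
  "extra_steps m = {(q, r). q \<in> above m \<and> r \<in> above m \<and>
     (\<exists>i\<in>extra_segments. q = lower i \<and> r = upper i \<or> q = upper i \<and> r = lower i)}"

lemma card_extra_steps:
  "finite (extra_steps m)" "card (extra_steps m) \<le> 2 * card extra_segments"
proof -
  define A B where "A = (\<lambda>i. (lower i, upper i)) ` extra_segments"
    and "B = (\<lambda>i. (upper i, lower i)) ` extra_segments"
  have sub: "extra_steps m \<subseteq> A \<union> B"
    unfolding A_def B_def extra_steps_def by auto
  have fin: "finite extra_segments"
    using card_segments(1) by (simp add: extra_segments_def)
  then have "finite A" "finite B" "card A \<le> card extra_segments" "card B \<le> card extra_segments"
    by (auto simp: A_def B_def card_image_le)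
  then show "finite (extra_steps m)" "card (extra_steps m) \<le> 2 * card extra_segments"
    using sub card_mono[of "A \<union> B" "extra_steps m"] card_Un_le[of A B] finite_subset[of _ "A \<union> B"]
    by auto
qed

lemma steps_above_cases:
  "steps_above m \<subseteq> parent_steps m \<union> (parent_steps m)\<inverse> \<union> extra_steps m"
proof (rule subrelI)
  fix q r assume qr: "(q, r) \<in> steps_above m"
  then obtain i where i: "i \<in> segments" "q = lower i \<and> r = upper i \<or> q = upper i \<and> r = lower i"
    and high: "q \<in> above m" "r \<in> above m"
    by (auto simp: steps_above_def adjacent_def)
  show "(q, r) \<in> parent_steps m \<union> (parent_steps m)\<inverse> \<union> extra_steps m"
  proof (cases "i \<in> extra_segments")
    case True
    then show ?thesis
      using i high by (auto simp: extra_steps_def)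
  next
    case False
    then obtain w where w: "w \<in> W" "w \<noteq> p" "i = parent_segment w"
      using i(1) by (auto simp: extra_segments_def)
    have "{w, parent w} = {q, r}"
      using descends_parent[OF w(1,2)] i w(3) unfolding descends_def by auto
    then have "w = q \<and> parent w = r \<or> w = r \<and> parent w = q"
      by (metis doubleton_eq_iff)
    then show ?thesis
      using w high by (auto simp: parent_steps_def above_def)
  qed
qed

lemma links_sym: "(u, v) \<in> links m \<Longrightarrow> (v, u) \<in> links m"
  by (simp add: links_def gromov_product_def path_dist_sym[of v u] add.commute)

lemma parent_steps_ancestor:
  assumes "(u, w) \<in> (parent_steps m)\<^sup>*" "u \<in> W"
  shows "w \<in> W" "D u w \<le> h u - h w" "u \<in> above m \<Longrightarrow> w \<in> above m"
proof -
  have "w \<in> W \<and> D u w \<le> h u - h w \<and> (u \<in> above m \<longrightarrow> w \<in> above m)"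
    using assms(1)
  proof (induction rule: rtrancl_induct)
    case base
    then show ?case
      using assms(2) path_dist_self marked_subset by auto
  next
    case (step v w)
    then have v: "v \<in> W" "v \<noteq> p" "w = parent v" "m \<le> h w"
      by (auto simp: parent_steps_def)
    have d: "descends v (parent_segment v) w"
      using descends_parent v by simp
    then have seg: "parent_segment v \<in> segments"
      by (simp add: descends_def)
    have "w \<in> W" "D v w \<le> gap (parent_segment v)"
      using segment_ends[OF seg] d unfolding descends_def by (auto simp: doubleton_eq_iff)
    moreover have "h w + gap (parent_segment v) \<le> h v"
      using d by (simp add: descends_def)
    moreover have "D u w \<le> D u v + D v w"
      using path_dist_triangle assms(2) v(1) \<open>w \<in> W\<close> marked_subset by blast
    ultimately show ?case
      using step.IH v(4) by (auto simp: above_def)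
  qed
  then show "w \<in> W" "D u w \<le> h u - h w" "u \<in> above m \<Longrightarrow> w \<in> above m"
    by auto
qed

text \<open>Two points with a common ancestor at height at least \<open>m\<close> are joined to \<open>p\<close> by geodesics
  that agree up to that height.\<close>

lemma common_ancestor_link:
  assumes "u \<in> above m" "(u, v) \<in> (parent_steps m)\<^sup>* O ((parent_steps m)\<^sup>*)\<inverse>"
  shows "(u, v) \<in> links m"
proof -
  obtain w where w: "(u, w) \<in> (parent_steps m)\<^sup>*" "(v, w) \<in> (parent_steps m)\<^sup>*"
    using assms(2) by auto
  have u: "u \<in> W"
    using assms(1) by (simp add: above_def)
  have "w \<in> above m"
    using parent_steps_ancestor(3)[OF w(1) u] assms(1) by blast
  have v: "v \<in> W"
    using w(2) \<open>w \<in> above m\<close> by (cases rule: converse_rtranclE) (auto simp: above_def parent_steps_def)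
  have P: "u \<in> P" "v \<in> P" "w \<in> P"
    using u v parent_steps_ancestor(1)[OF w(1) u] marked_subset by auto
  have "D u v \<le> D u w + D v w"
    using path_dist_triangle[OF P(1,3,2)] path_dist_sym[of w v] by simp
  also have "\<dots> \<le> (h u - h w) + (h v - h w)"
    using parent_steps_ancestor(2)[OF w(1) u] parent_steps_ancestor(2)[OF w(2) v] by simp
  finally have "h w \<le> gromov_product D p u v"
    by (simp add: gromov_product_def)
  then show ?thesis
    using \<open>w \<in> above m\<close> P by (simp add: links_def above_def)
qed

text \<open>There is no marked point inside a segment, in particular \<open>p\<close> is not there, so every path from
  \<open>p\<close> enters the segment through one of its ends.\<close>

lemma height_on_segment:
  assumes "e \<in> E" "s \<in> coords e" "s < len G e" "s \<le> t" "t \<le> next_coord e s"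
  shows "min (h (pt e s) + (t - s)) (h (pt e (next_coord e s)) + (next_coord e s - t)) \<le> h (pt e t)"
proof -
  define b where "b = next_coord e s"
  note n = next_coord[OF assms(1,3), folded b_def]
  have range: "0 \<le> s" "s \<le> len G e" "0 \<le> b" "b \<le> len G e"
    using assms(2) n(1) by (auto simp: coords_def)
  have pP: "p \<in> P"
    using base_marked marked_subset by blast
  have bound: "min (h (pt e s) + (t - s)) (h (pt e b) + (b - t)) \<le> c"
    if "path_length G q r c" "q = p" "r = pt e t" "s < t" "t < b" for q r c t
    using that
  proof (induction arbitrary: t rule: path_length.induct)
    case (refl q)
    then have "t \<in> coords e"
      using base_marked range by (auto simp: coords_def)
    then show ?case
      using n(3)[of t] refl by simp
  next
    case (step q r' c f s1 r s2)
    have f: "f \<in> E" "0 \<le> s1" "s1 \<le> len G f" "r' = pt f s1" "r = pt f s2"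
      using step.hyps by (auto simp: edge_coord_iff)
    have "r = Inner e t"
      using step.prems range by (simp add: edge_point_def)
    then have "f = e" "s2 = t"
      using f(5) by (auto simp: edge_point_def split: if_splits)
    show ?case
    proof (cases "s < s1 \<and> s1 < b")
      case True
      have "min (h (pt e s) + (s1 - s)) (h (pt e b) + (b - s1)) \<le> c"
        using step.IH[of s1] True step.prems(1) f(4) \<open>f = e\<close> by blast
      then show ?thesis
        using \<open>s2 = t\<close> by linarith
    next
      case False
      have "h (pt e s1) \<le> c"
        using path_dist_le[OF step.hyps(1)] step.prems(1) f(4) \<open>f = e\<close> by simp
      moreover have "h (pt e s) \<le> h (pt e s1) + \<bar>s - s1\<bar>" "h (pt e b) \<le> h (pt e s1) + \<bar>b - s1\<bar>"
        using path_dist_lipschitz[OF pP assms(1)] range f(2,3) \<open>f = e\<close> by auto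
      ultimately show ?thesis
        using False step.prems \<open>s2 = t\<close> by linarith
    qed
  qed
  show ?thesis
  proof (cases "s < t \<and> t < b")
    case True
    then show ?thesis
      using bound[of p "pt e t" _ t] range edge_point_in_realization[OF assms(1), of t] pP
      unfolding b_def[symmetric] by (intro path_dist_greatest) auto
  next
    case False
    then have "t = s \<or> t = b"
      using assms(4,5) by (auto simp: b_def)
    then show ?thesis
      by (auto simp: b_def)
  qed
qed

text \<open>The point of a segment at which geodesics from \<open>p\<close> through either end meet lies beyond each
  end on such a geodesic.\<close>

lemma segment_links:
  assumes "i \<in> segments" "lower i \<in> above m" "upper i \<in> above m"
  shows "(lower i, upper i) \<in> links m O links m"
proof -
  obtain e s where i: "i = (e, s)" "e \<in> E" "s \<in> coords e" "s < len G e"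
    using assms by (auto simp: segments_def)
  define b where "b = next_coord e s"
  note n = next_coord[OF i(2,4), folded b_def]
  have range: "0 \<le> s" "s \<le> len G e" "0 \<le> b" "b \<le> len G e"
    using i(3) n(1) by (auto simp: coords_def)
  have pP: "p \<in> P"
    using base_marked marked_subset by blast
  have ends: "lower i = pt e s" "upper i = pt e b"
    by (auto simp: i lower_def upper_def b_def)
  have lip: "\<bar>h (pt e b) - h (pt e s)\<bar> \<le> b - s"
    using path_dist_lipschitz[OF pP i(2), of s b] path_dist_lipschitz[OF pP i(2), of b s] range n(2)
    by simp
  \<comment> \<open>the solution of \<open>h (pt e s) + (t - s) = h (pt e b) + (b - t)\<close>\<close>
  define t where "t = (h (pt e b) - h (pt e s) + s + b) / 2"
  have t: "s \<le> t" "t \<le> b"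
    using lip by (auto simp: t_def field_simps abs_le_iff)
  have "h (pt e s) + (t - s) = h (pt e b) + (b - t)"
    by (simp add: t_def field_simps)
  then have ht: "h (pt e s) + (t - s) \<le> h (pt e t)" "h (pt e b) + (b - t) \<le> h (pt e t)"
    using height_on_segment[OF i(2,3,4) t(1)] t(2) by (auto simp: b_def)
  have "D (pt e s) (pt e t) \<le> t - s" "D (pt e t) (pt e b) \<le> b - t"
    using path_dist_edge[OF i(2), of s t] path_dist_edge[OF i(2), of t b] t range by auto
  then have "h (pt e s) \<le> gromov_product D p (pt e s) (pt e t)"
      "h (pt e b) \<le> gromov_product D p (pt e t) (pt e b)"
    using ht by (auto simp: gromov_product_def)
  moreover have "pt e s \<in> P" "pt e t \<in> P" "pt e b \<in> P"
    using edge_point_in_realization[OF i(2)] t range by auto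
  ultimately have "(pt e s, pt e t) \<in> links m" "(pt e t, pt e b) \<in> links m"
    using assms(2,3) ends by (auto simp: links_def above_def)
  then show ?thesis
    unfolding ends by blast
qed

lemma few_links:
  assumes "(x, y) \<in> (steps_above m)\<^sup>*" "x \<in> above m"
  shows "\<exists>n \<le> 6 * card extra_segments + 1. 1 \<le> n \<and> (x, y) \<in> links m ^^ n"
proof -
  let ?T = "parent_steps m" and ?Q = "extra_steps m"
  have sv: "single_valued ?T"
    by (auto simp: single_valued_def parent_steps_def)
  have "(x, y) \<in> (?T \<union> ?T\<inverse> \<union> ?Q)\<^sup>*"
    using assms(1) rtrancl_mono[OF steps_above_cases[of m]] by blast
  then obtain n where n: "n \<le> card ?Q"
    "(x, y) \<in> (?T\<^sup>* O (?T\<^sup>*)\<inverse>) O (?Q O (?T\<^sup>* O (?T\<^sup>*)\<inverse>)) ^^ n"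
    using rtrancl_single_valued_few_steps[OF sv card_extra_steps(1)] by blast
  have "(x, y) \<in> links m ^^ (3 * n + 1)"
  proof (rule few_steps_to_links[OF common_ancestor_link _ assms(2) n(2)])
    fix u v assume uv: "(u, v) \<in> ?Q"
    then obtain i where i: "i \<in> extra_segments"
        "u = lower i \<and> v = upper i \<or> u = upper i \<and> v = lower i" "u \<in> above m" "v \<in> above m"
      by (auto simp: extra_steps_def)
    have "(lower i, upper i) \<in> links m O links m"
      using segment_links[of i m] i by (auto simp: extra_segments_def)
    then have "(u, v) \<in> links m O links m"
      using i(2) links_sym by blast
    then show "v \<in> above m \<and> (u, v) \<in> links m O links m"
      using i(4) by blast
  qed
  moreover have "3 * n + 1 \<le> 6 * card extra_segments + 1"
    using n(1) card_extra_steps(2)[of m] by linarith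
  ultimately show ?thesis
    by (intro exI[of _ "3 * n + 1"]) auto
qed

text \<open>With \<open>k\<close> the least number of halvings for \<open>6 \<beta> + 1\<close> links, \<open>2\<^sup>k\<close> is less than
  \<open>2 (6 \<beta> + 1) \<le> (4 \<beta> + 4)\<^sup>2\<close>, and the square accounts for the factor \<open>2\<close> in \<open>phi\<close>.\<close>

lemma product_ge_of_steps_above:
  assumes "(x, y) \<in> (steps_above m)\<^sup>*" "x \<in> above m"
  shows "m - phi G \<le> gromov_product D p x y"
proof -
  define \<beta> where "\<beta> = card extra_segments"
  have \<beta>: "real \<beta> = real_of_int (betti1 G)"
    using card_extra_segments unfolding \<beta>_def by (metis of_int_of_nat_eq)
  define k where "k = nat \<lceil>log 2 (real (6 * \<beta> + 1))\<rceil>"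
  have log0: "log 2 (real (6 * \<beta> + 1)) \<ge> 0"
    by simp
  have "real (6 * \<beta> + 1) = 2 powr log 2 (real (6 * \<beta> + 1))"
    by simp
  also have "\<dots> \<le> 2 powr real k"
    unfolding k_def by (intro powr_mono real_nat_ceiling_ge) auto
  finally have "real (6 * \<beta> + 1) \<le> real (2 ^ k)"
    by (simp add: powr_realpow)
  then have pow: "6 * \<beta> + 1 \<le> 2 ^ k"
    by (simp only: of_nat_le_iff)
  have "real k = of_int \<lceil>log 2 (real (6 * \<beta> + 1))\<rceil>"
    using log0 unfolding k_def by (simp add: ceiling_less_iff)
  then have "real k \<le> log 2 (real (6 * \<beta> + 1)) + 1"
    by linarith
  also have "\<dots> = log 2 (real (6 * \<beta> + 1) * 2)"
    by (subst log_mult) auto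
  also have "\<dots> \<le> log 2 ((4 * real \<beta> + 4)\<^sup>2)"
  proof (subst log_le_cancel_iff)
    show "0 < (4 * real \<beta> + 4)\<^sup>2"
      by (rule zero_less_power) simp
    show "real (6 * \<beta> + 1) * 2 \<le> (4 * real \<beta> + 4)\<^sup>2"
      by (simp add: power2_eq_square algebra_simps)
  qed auto
  also have "\<dots> = 2 * log 2 (4 * real \<beta> + 4)"
    by (simp add: log_nat_power)
  finally have "real k * graph_hyp G \<le> 2 * log 2 (4 * real \<beta> + 4) * graph_hyp G"
    using graph_hyp_nonneg by (rule mult_right_mono)
  also have "\<dots> = phi G"
    by (simp add: phi_def \<beta>)
  finally have "real k * graph_hyp G \<le> phi G" .
  moreover have "m - real k * graph_hyp G \<le> gromov_product D p x y"
  proof -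
    obtain n where n: "n \<le> 6 * card extra_segments + 1" "1 \<le> n" "(x, y) \<in> links m ^^ n"
      using few_links[OF assms] by blast
    show ?thesis
    proof (rule halving[OF _ graph_hyp_nonneg _ n(3,2)])
      show "min (gromov_product D p x y) (gromov_product D p y z) - graph_hyp G
          \<le> gromov_product D p x z" if "x \<in> P" "y \<in> P" "z \<in> P" for x y z
        using gromov_product_ge_minus_graph_hyp that base_marked marked_subset by blast
      show "links m \<subseteq> {(u, v). u \<in> P \<and> v \<in> P \<and> m \<le> gromov_product D p u v}"
        by (auto simp: links_def)
      show "n \<le> 2 ^ k"
        using n(1) pow by (simp add: \<beta>_def)
    qed
  qed
  ultimately show ?thesis
    by linarith
qed

end

section \<open>Every finite metric space embeds into a metric graph\<close>

text \<open>The complete graph whose edge lengths are the distances works: the distance from a vertex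
  \<open>b x\<close> extends to a function on the realization that is \<open>1\<close>-Lipschitz along every edge, by taking
  on each edge the smaller of the two values prescribed by its ends, so no path is a shortcut.\<close>

lemma (in Metric_space) embeds_in_complete_graph:
  assumes "finite M" "M \<noteq> {}"
  shows "\<exists>G :: nat mgraph. metric_graph G \<and> embeds_in M d G"
proof -
  obtain b :: "'a \<Rightarrow> nat" where b: "inj_on b M"
    using finite_imp_inj_to_nat_seg[OF assms(1)] by blast
  define c where "c = the_inv_into M b"
  have c: "c (b x) = x" if "x \<in> M" for x
    using the_inv_into_f_f[OF b that] by (simp add: c_def)
  define G :: "nat mgraph" where
    "G = \<lparr>verts = b ` M, edges = {{b x, b y} | x y. x \<in> M \<and> y \<in> M \<and> x \<noteq> y},
          len = (\<lambda>e. d (c (Min e)) (c (Max e)))\<rparr>"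
  have edge: "\<exists>u\<in>M. \<exists>v\<in>M. u \<noteq> v \<and> e = {b u, b v} \<and> Min e = b u \<and> Max e = b v \<and> len G e = d u v"
    if e: "e \<in> edges G" for e
  proof -
    obtain x y where xy: "x \<in> M" "y \<in> M" "x \<noteq> y" "e = {b x, b y}"
      using e by (auto simp: G_def)
    have "b x \<noteq> b y"
      using xy b by (auto dest: inj_onD)
    then consider "b x < b y" | "b y < b x"
      by linarith
    then have "Min e = b x \<and> Max e = b y \<or> Min e = b y \<and> Max e = b x"
      using xy(4) by cases auto
    moreover have "len G e = d (c (Min e)) (c (Max e))" "e = {b y, b x}"
      using xy(4) by (auto simp: G_def)
    ultimately show ?thesis
      using xy c by metis
  qed
  have mg: "metric_graph G"
    unfolding metric_graph_def
  proof (intro conjI ballI)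
    show "finite (verts G)" "verts G \<noteq> {}"
      using assms by (auto simp: G_def)
    fix e assume "e \<in> edges G"
    then obtain u v where uv: "u \<in> M" "v \<in> M" "u \<noteq> v" "e = {b u, b v}" "len G e = d u v"
      using edge by blast
    then show "e \<subseteq> verts G" "card e = 2" "0 < len G e"
      using inj_onD[OF b, of u v] by (auto simp: G_def card_insert_if)
  next
    fix u v assume "u \<in> verts G" "v \<in> verts G"
    then show "(u, v) \<in> {(a, b). {a, b} \<in> edges G}\<^sup>*"
      by (cases "u = v") (auto simp: G_def)
  qed
  interpret connected_metric_graph G
    by unfold_locales (rule mg)
  have vert: "Vertex (b x) \<in> P" if "x \<in> M" for x
    using that by (auto simp: realization_def G_def)
  have le: "D (Vertex (b x)) (Vertex (b y)) \<le> d x y" if "x \<in> M" "y \<in> M" for x y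
  proof (cases "x = y")
    case True
    then show ?thesis
      using path_dist_self[OF vert] that by simp
  next
    case False
    define e where "e = {b x, b y}"
    have e: "e \<in> E"
      using that False by (auto simp: e_def G_def)
    have pts: "pt e 0 = Vertex (Min e)" "pt e (len G e) = Vertex (Max e)"
      using len_pos[OF e] by (auto simp: edge_point_def)
    obtain u v where uv: "u \<in> M" "v \<in> M" "e = {b u, b v}" "Min e = b u" "Max e = b v" "len G e = d u v"
      using edge[OF e] by blast
    have D_uv: "D (Vertex (b u)) (Vertex (b v)) \<le> d u v"
      using path_dist_edge[OF e, of 0 "len G e"] len_pos[OF e] pts uv by simp
    have "b x = b u \<and> b y = b v \<or> b x = b v \<and> b y = b u"
      using uv(3) unfolding e_def by (auto simp: doubleton_eq_iff)
    then have "x = u \<and> y = v \<or> x = v \<and> y = u"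
      using c that uv(1,2) by metis
    then show ?thesis
      using D_uv by (auto simp: commute path_dist_sym[of "Vertex (b v)"])
  qed
  have ge: "d x y \<le> D (Vertex (b x)) (Vertex (b y))" if xy: "x \<in> M" "y \<in> M" for x y
  proof -
    define F where "F e s = min (d x (c (Min e)) + s) (d x (c (Max e)) + (len G e - s))"
      for e and s :: real
    have ends: "F e 0 = d x (c (Min e))" "F e (len G e) = d x (c (Max e))" if e: "e \<in> E" for e
    proof -
      obtain u v where "u \<in> M" "v \<in> M" "c (Min e) = u" "c (Max e) = v" "len G e = d u v"
        using edge[OF e] c by metis
      then show "F e 0 = d x (c (Min e))" "F e (len G e) = d x (c (Max e))"
        using triangle[of x v u] triangle[of x u v] xy commute[of u v] by (auto simp: F_def)
    qed
    define H where "H q = (case q of Vertex v \<Rightarrow> d x (c v) | Inner e s \<Rightarrow> F e s)" for q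
    have H: "H (pt e s) = F e s" if "e \<in> E" "0 \<le> s" "s \<le> len G e" for e s
      using ends[OF that(1)] by (auto simp: H_def edge_point_def)
    have lip: "F e s' \<le> F e s + \<bar>s - s'\<bar>" for e s s'
      by (auto simp: F_def min_def)
    have "H r \<le> a" if "path_length G q r a" "q = Vertex (b x)" for q r a
      using that
    proof (induction rule: path_length.induct)
      case (refl q)
      then show ?case
        using c xy by (simp add: H_def)
    next
      case (step q r' a e s r s')
      then show ?case
        using H[of e s] H[of e s'] lip[of e s' s] by (simp add: edge_coord_iff)
    qed
    then have "H (Vertex (b y)) \<le> D (Vertex (b x)) (Vertex (b y))"
      using vert xy by (intro path_dist_greatest) auto
    then show ?thesis
      using c xy by (simp add: H_def)
  qed
  have "embeds_in M d G"
    unfolding embeds_in_def using vert le ge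
    by (intro exI[of _ "\<lambda>x. Vertex (b x)"]) (auto intro: order_antisym)
  then show ?thesis
    using mg by blast
qed

section \<open>The approximation theorem\<close>

text \<open>The images of consecutive points of a chain in \<open>M\<close> are joined by a walk in \<open>G\<close> that loses an
  arbitrarily small amount of height; the walks are concatenated and then shortened inside \<open>G\<close>.\<close>

lemma (in Metric_space) chain_product_le_phi:
  assumes "finite M" and G: "metric_graph G" "embeds_in M d G"
    and M: "p \<in> M" "x \<in> M" "y \<in> M"
  shows "chain_product d p M x y \<le> gromov_product d p x y + phi G"
proof -
  obtain f where f: "f ` M \<subseteq> realization G" "\<And>x y. x \<in> M \<Longrightarrow> y \<in> M \<Longrightarrow> path_dist G (f x) (f y) = d x y"
    using G(2) unfolding embeds_in_def by blast
  interpret marked_metric_graph G "Vertex ` verts G \<union> f ` M" "f p"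
    using G(1) f(1) M(1) \<open>finite M\<close>
    by unfold_locales (auto simp: metric_graph_def realization_def)
  have prod: "gromov_product D (f p) (f u) (f v) = gromov_product d p u v" if "u \<in> M" "v \<in> M" for u v
    using f(2) that M(1) by (simp add: gromov_product_def)
  show ?thesis
  proof (rule chain_product_least[OF M])
    fix m assume chain: "(x, y) \<in> (product_links d p M m)\<^sup>+"
    show "m \<le> gromov_product d p x y + phi G"
    proof (rule field_le_epsilon)
      fix \<epsilon> :: real assume "\<epsilon> > 0"
      have step: "f u \<in> above (m - \<epsilon>) \<and> (f u, f v) \<in> (steps_above (m - \<epsilon>))\<^sup>*"
        if "(u, v) \<in> product_links d p M m" for u v
        using steps_above_of_product[of "f u" "f v" "m - \<epsilon>"] prod[of u v] that \<open>\<epsilon> > 0\<close>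
        by (auto simp: product_links_def)
      have "f x \<in> above (m - \<epsilon>) \<and> (f x, f y) \<in> (steps_above (m - \<epsilon>))\<^sup>*"
        using chain by (induction rule: trancl_induct) (use step in \<open>auto intro: rtrancl_trans\<close>)
      then have "m - \<epsilon> - phi G \<le> gromov_product D (f p) (f x) (f y)"
        using product_ge_of_steps_above by blast
      then show "m \<le> gromov_product d p x y + phi G + \<epsilon>"
        using prod M by simp
    qed
  qed
qed

theorem theorem1p1:
  fixes X :: "'a set" and d :: "'a \<Rightarrow> 'a \<Rightarrow> real"
  assumes "finite X" and "X \<noteq> {}" and "Metric_space X d"
  shows "\<exists>t. tree_metric X t \<and> sup_distance X d t \<le> Phi X d"
proof -
  interpret Metric_space X d
    by (rule assms)
  obtain p where p: "p \<in> X"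
    using assms by blast
  have "chain_product d p X x y - gromov_product d p x y \<le> Phi X d" if "x \<in> X" "y \<in> X" for x y
    unfolding Phi_def
  proof (rule cInf_greatest)
    show "{phi G | G :: nat mgraph. metric_graph G \<and> embeds_in X d G} \<noteq> {}"
      using embeds_in_complete_graph[OF assms(1,2)] by blast
    fix z assume "z \<in> {phi G | G :: nat mgraph. metric_graph G \<and> embeds_in X d G}"
    then obtain G :: "nat mgraph" where "z = phi G" "metric_graph G" "embeds_in X d G"
      by blast
    then show "chain_product d p X x y - gromov_product d p x y \<le> z"
      using chain_product_le_phi[OF assms(1) _ _ p that] by (simp add: algebra_simps)
  qed
  then have "chain_product d p X x y \<le> gromov_product d p x y + Phi X d" if "x \<in> X" "y \<in> X" for x y
    using that by (simp add: algebra_simps)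
  then obtain t where t: "tree_metric X t" "\<forall>x\<in>X. \<forall>y\<in>X. \<bar>d x y - t x y\<bar> \<le> Phi X d"
    using tree_metric_from_chains[OF assms(1) p] by blast
  have "sup_distance X d t \<le> Phi X d"
    unfolding sup_distance_def
  proof (subst Max_le_iff)
    have eq: "{\<bar>d x x' - t x x'\<bar> | x x'. x \<in> X \<and> x' \<in> X} = (\<lambda>(x, x'). \<bar>d x x' - t x x'\<bar>) ` (X \<times> X)"
      by auto
    show "finite {\<bar>d x x' - t x x'\<bar> | x x'. x \<in> X \<and> x' \<in> X}"
      unfolding eq using assms(1) by simp
    show "{\<bar>d x x' - t x x'\<bar> | x x'. x \<in> X \<and> x' \<in> X} \<noteq> {}"
      using p by blast
    show "\<forall>a\<in>{\<bar>d x x' - t x x'\<bar> | x x'. x \<in> X \<and> x' \<in> X}. a \<le> Phi X d"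
      using t(2) by blast
  qed
  then show ?thesis
    using t(1) by blast
qed

end
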